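(* Let $\mathsf{1\text{-}turn\text{-}Dyck}_2 = \{ w \bar{w}^R : w \in \{(, [\}^n,\ n \geq 1\}$. Then: (1) any $p$-pass randomized streaming algorithm that determines membership in $\mathsf{1\text{-}turn\text{-}Dyck}_2$ with probability of error bounded by a constant $\epsilon < \frac{1}{2}$ must use $\Omega((\log n)/p)$ space; (2) any $p$-pass deterministic streaming algorithm that determines membership in $\mathsf{1\text{-}turn\text{-}Dyck}_2$ must use $\Omega(n/p)$ space.
   Context: For a string $w$ over $\{(,[\}$, $\bar{w}$ denotes the string obtained from $w$ by replacing each opening parenthesis by its corresponding closing parenthesis ($($ by $)$ and $[$ by $]$), and $\bar{w}^R$ is the reverse of $\bar{w}$. A $p$-pass streaming algorithm reads its input sequentially from left to right $p$ times; its space is the number of bits of working memory used. Here $n$ denotes the length parameter of the input. *)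

theory Defs
  imports "HOL-Probability.Probability" "HOL-Library.Landau_Symbols"
begin

datatype paren = LPar | RPar | LBrk | RBrk

fun closing :: "paren \<Rightarrow> paren" where
  "closing LPar = RPar"
| "closing LBrk = RBrk"
| "closing RPar = RPar"
| "closing RBrk = RBrk"

definition bar :: "paren list \<Rightarrow> paren list" where
  "bar w = map closing w"

definition one_turn_Dyck2 :: "paren list set" where
  "one_turn_Dyck2 =
     {w @ rev (bar w) | w n. set w \<subseteq> {LPar, LBrk} \<and> length w = n \<and> n \<ge> 1}"

text \<open>
  What a \<open>p\<close>-pass algorithm sees on input \<open>x\<close>: the string \<open>x\<close> is presented \<open>p\<close> times from left
  to right, each time followed by the end marker \<^term>\<open>None\<close>. Every item also carries the number
  of the current pass, so that an algorithm may run a different program in each pass without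
  being charged memory for the pass counter.
\<close>

definition passes :: "nat \<Rightarrow> 'a list \<Rightarrow> (nat \<times> 'a option) list" where
  "passes p x = concat (map (\<lambda>i. map (Pair i) (map Some x @ [None])) [0..<p])"

text \<open>
  The working memory is a string of bits and is all that is carried from one item of the stream
  to the next. Random choices are made afresh at every step: coin tosses that the algorithm
  wants to remember have to be kept in its memory. What is computed internally during a single
  step is not charged. Only the memory contents between steps count as space, which can only
  make a lower bound stronger.
\<close>

record 'a rand_alg =
  rand_init :: "bool list pmf"
  rand_step :: "bool list \<Rightarrow> nat \<times> 'a option \<Rightarrow> bool list pmf"
  rand_out :: "bool list \<Rightarrow> bool pmf"

record 'a det_alg =
  det_init :: "bool list"
  det_step :: "bool list \<Rightarrow> nat \<times> 'a option \<Rightarrow> bool list"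
  det_out :: "bool list \<Rightarrow> bool"

definition rand_run :: "'a rand_alg \<Rightarrow> (nat \<times> 'a option) list \<Rightarrow> bool list pmf" where
  "rand_run A xs = foldl (\<lambda>M a. bind_pmf M (\<lambda>m. rand_step A m a)) (rand_init A) xs"

definition det_run :: "'a det_alg \<Rightarrow> (nat \<times> 'a option) list \<Rightarrow> bool list" where
  "det_run A xs = foldl (det_step A) (det_init A) xs"

definition rand_answer :: "'a rand_alg \<Rightarrow> nat \<Rightarrow> 'a list \<Rightarrow> bool pmf" where
  "rand_answer A p x = bind_pmf (rand_run A (passes p x)) (rand_out A)"

definition det_answer :: "'a det_alg \<Rightarrow> nat \<Rightarrow> 'a list \<Rightarrow> bool" where
  "det_answer A p x = det_out A (det_run A (passes p x))"

definition rand_determines ::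
    "'a rand_alg \<Rightarrow> nat \<Rightarrow> real \<Rightarrow> 'a list set \<Rightarrow> nat \<Rightarrow> bool" where
  "rand_determines A p \<epsilon> L N \<longleftrightarrow>
     (\<forall>x. length x = N \<longrightarrow>
        measure_pmf.prob (rand_answer A p x) {b. b \<noteq> (x \<in> L)} \<le> \<epsilon>)"

definition det_determines :: "'a det_alg \<Rightarrow> nat \<Rightarrow> 'a list set \<Rightarrow> nat \<Rightarrow> bool" where
  "det_determines A p L N \<longleftrightarrow> (\<forall>x. length x = N \<longrightarrow> det_answer A p x = (x \<in> L))"

text \<open>
  Space is measured in the worst case over all inputs of length \<open>N\<close>, all points in time \<open>t\<close> and,
  for randomized algorithms, all outcomes of the coin tosses.
\<close>

definition rand_space_le :: "'a rand_alg \<Rightarrow> nat \<Rightarrow> nat \<Rightarrow> nat \<Rightarrow> bool" where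
  "rand_space_le A p N s \<longleftrightarrow>
     (\<forall>x t. length x = N \<longrightarrow>
        (\<forall>m \<in> set_pmf (rand_run A (take t (passes p x))). length m \<le> s))"

definition det_space_le :: "'a det_alg \<Rightarrow> nat \<Rightarrow> nat \<Rightarrow> nat \<Rightarrow> bool" where
  "det_space_le A p N s \<longleftrightarrow>
     (\<forall>x t. length x = N \<longrightarrow> length (det_run A (take t (passes p x))) \<le> s)"

text \<open>
  Lower bounds are stated for families \<open>A\<close> of algorithms, \<open>A n\<close> being responsible for the inputs
  of length \<open>2 * n\<close> (the members of the language have even length). Such an algorithm
  may know \<open>n\<close> in advance. An algorithm that works for all lengths is the special case of a
  constant family, its space still being a function of \<open>n\<close>. The number of passes may depend on
  \<open>n\<close> as well.
\<close>

end

theory Submission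
  imports Defs
begin

text \<open>
  Split an input of length \<open>2n\<close> as \<open>u @ rev (bar v)\<close> with \<open>u\<close>, \<open>v\<close> of length \<open>n\<close>: membership is
  equality of \<open>u\<close> and \<open>v\<close>, and only the memory contents cross the middle.

  Deterministic case: if \<open>u\<close> and \<open>u'\<close> have the same crossing sequence (the memory at the middle and
  at the end of each pass) on their matching inputs, then \<open>u @ rev (bar u')\<close> is accepted. Hence
  there are at least \<open>2 ^ n\<close> crossing sequences, while there are only \<open>2 ^ O(p s)\<close> possible ones.

  Randomized case: in each pass \<open>u\<close> acts by a stochastic kernel on the \<open>S \<le> 4 ^ s\<close> memory contents.
  Changing all entries of the kernels by at most \<open>\<delta>\<close> changes the acceptance probability by at most
  \<open>p S \<delta>\<close>. So rounding the entries to multiples of \<open>1 / N\<close>, with \<open>N\<close> a constant times \<open>p S\<close>, keeps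
  the \<open>2 ^ n\<close> words \<open>u\<close> apart, whence \<open>2 ^ n \<le> (N + 1) ^ (p S\<^sup>2)\<close> and
  \<open>log n = O(s + log p + 1)\<close>. This is enough because \<open>log p \<le> p s\<close> once \<open>s \<ge> 1\<close>.
\<close>

section \<open>Membership as equality of the two halves\<close>

definition openings :: "nat \<Rightarrow> paren list set" where
  "openings n = {w. set w \<subseteq> {LPar, LBrk} \<and> length w = n}"

lemma length_openings: "w \<in> openings n \<Longrightarrow> length w = n"
  by (simp add: openings_def)

lemma length_bar [simp]: "length (bar w) = length w"
  by (simp add: bar_def)

lemma card_openings: "card (openings n) = 2 ^ n"
proof -
  have "card {LPar, LBrk} = 2"
    by simp
  then show ?thesis
    by (simp only: openings_def card_lists_length_eq finite.intros)
qed

text \<open>\<open>closing\<close> also fixes the closing parentheses, so only words of opening ones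
  can be recovered from their \<open>bar\<close>.\<close>

lemma inj_on_bar: "inj_on bar (openings n)"
proof -
  have "inj_on closing {LPar, LBrk}"
    by (auto simp: inj_on_def)
  then have "inj_on bar (lists {LPar, LBrk})"
    unfolding bar_def[abs_def] by (rule inj_on_map_lists)
  then show ?thesis
    by (rule inj_on_subset) (auto simp: openings_def)
qed

lemma one_turn_Dyck2_iff:
  assumes "n \<ge> 1" "u \<in> openings n" "v \<in> openings n"
  shows "u @ rev (bar v) \<in> one_turn_Dyck2 \<longleftrightarrow> u = v"
proof
  assume "u @ rev (bar v) \<in> one_turn_Dyck2"
  then obtain w where w: "u @ rev (bar v) = w @ rev (bar w)" "set w \<subseteq> {LPar, LBrk}"
    by (auto simp: one_turn_Dyck2_def)
  \<comment> \<open>Equal halves force any witness \<open>w\<close> to split the input at the same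
    place.\<close>
  have "length u + length v = 2 * length w"
    using arg_cong[OF w(1), of length] by simp
  then have "length u = length w"
    using assms by (simp add: length_openings)
  with w(1) have "u = w" "bar v = bar w"
    by auto
  with assms show "u = v"
    using inj_onD[OF inj_on_bar] by metis
qed (use assms in \<open>auto simp: one_turn_Dyck2_def openings_def\<close>)

section \<open>Memory contents in bounded space\<close>

definition memories :: "nat \<Rightarrow> bool list set" where
  "memories s = {m. length m \<le> s}"

lemma finite_memories: "finite (memories s)"
  using finite_lists_length_le[of "UNIV :: bool set" s] by (simp add: memories_def)

text \<open>The exact value is \<open>2 ^ (s + 1) - 1\<close>. The cruder \<open>4 ^ s\<close> has a
  logarithm proportional to \<open>s\<close>, without an additive term.\<close>

lemma card_memories_le: "card (memories s) \<le> 4 ^ s"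
proof -
  have "card (memories s) = (\<Sum>i\<le>s. 2 ^ i)"
    using card_lists_length_le[of "UNIV :: bool set" s] by (simp add: memories_def)
  also have "\<dots> \<le> 4 ^ s"
  proof (induction s)
    case (Suc s)
    have "(2 :: nat) ^ s \<le> 4 ^ s"
      by (rule power_mono) auto
    with Suc show ?case
      by simp
  qed simp
  finally show ?thesis .
qed

section \<open>Prefixes of the stream\<close>

lemma passes_0 [simp]: "passes 0 x = []"
  by (simp add: passes_def)

lemma passes_Suc: "passes (Suc k) x = passes k x @ map (Pair k) (map Some x @ [None])"
  by (simp add: passes_def)

lemma passes_Suc_append:
  "passes (Suc k) (u @ v) =
     passes k (u @ v) @ map (Pair k) (map Some u) @ map (Pair k) (map Some v @ [None])"
  by (simp add: passes_Suc)

lemma passes_prefix: "k \<le> p \<Longrightarrow> \<exists>zs. passes p x = passes k x @ zs"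
  by (induction rule: dec_induct) (auto simp: passes_Suc)

lemma passes_take: "k \<le> p \<Longrightarrow> \<exists>t. take t (passes p x) = passes k x"
  using passes_prefix[of k p x] by (metis append_eq_conv_conj)

text \<open>Makes the space bounds, which speak of \<open>take t\<close>, available at the middle of
  a pass.\<close>

lemma passes_half_take:
  assumes "k < p"
  shows "\<exists>t. take t (passes p (u @ v)) = passes k (u @ v) @ map (Pair k) (map Some u)"
proof -
  obtain zs where "passes p (u @ v) = passes (Suc k) (u @ v) @ zs"
    using passes_prefix[of "Suc k" p "u @ v"] assms by (auto simp: Suc_le_eq)
  then have "passes p (u @ v) = (passes k (u @ v) @ map (Pair k) (map Some u)) @
      map (Pair k) (map Some v @ [None]) @ zs"
    by (simp only: passes_Suc_append append.assoc)
  then show ?thesis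
    by (metis append_eq_conv_conj)
qed

section \<open>Deterministic bound by crossing sequences\<close>

lemma det_run_append: "det_run A (xs @ ys) = foldl (det_step A) (det_run A xs) ys"
  by (simp add: det_run_def)

definition crossing :: "'a det_alg \<Rightarrow> 'a list \<Rightarrow> 'a list \<Rightarrow> nat \<Rightarrow> bool list \<times> bool list" where
  "crossing A u v k =
     (det_run A (passes k (u @ v) @ map (Pair k) (map Some u)),
      det_run A (passes (Suc k) (u @ v)))"

text \<open>Cut and paste: in each pass \<open>u\<close> carries the common starting memory to the
  middle memory of its run with \<open>v\<close>. From there \<open>v'\<close> behaves as in its run
  with \<open>u'\<close>, and the equal crossings make the pass end in the memory of
  \<open>u @ v\<close>.\<close>

lemma det_run_mix:
  assumes "\<And>k. k < p \<Longrightarrow> crossing A u v k = crossing A u' v' k" "k \<le> p"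
  shows "det_run A (passes k (u @ v')) = det_run A (passes k (u @ v))"
  using assms(2)
proof (induction k)
  case (Suc k)
  let ?u = "map (Pair k) (map Some u)" and ?v = "\<lambda>v. map (Pair k) (map Some v @ [None])"
  have eq: "crossing A u v k = crossing A u' v' k"
    using Suc.prems assms(1) by simp
  have "det_run A (passes k (u @ v') @ ?u) = det_run A (passes k (u @ v) @ ?u)"
    using Suc by (simp add: det_run_append)
  also have "\<dots> = fst (crossing A u' v' k)"
    using eq by (metis crossing_def fst_conv)
  finally have "det_run A (passes (Suc k) (u @ v')) =
      foldl (det_step A) (fst (crossing A u' v' k)) (?v v')"
    by (metis passes_Suc_append append.assoc det_run_append)
  also have "\<dots> = snd (crossing A u' v' k)"
    unfolding crossing_def fst_conv snd_conv passes_Suc_append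
    by (metis append.assoc det_run_append)
  finally show ?case
    using eq by (metis crossing_def snd_conv)
qed simp

lemma det_space_bound:
  assumes "n \<ge> 1" "det_determines A p one_turn_Dyck2 (2 * n)" "det_space_le A p (2 * n) s"
  shows "n \<le> 4 * s * p"
proof -
  define M where "M = memories s"
  \<comment> \<open>\<open>restrict\<close> forgets the passes from \<open>p\<close> on, so that
    \<open>f\<close> compares only the actual passes and has a finite range.\<close>
  define f where "f u = restrict (crossing A u (rev (bar u))) {..<p}" for u
  have range: "f \<in> openings n \<rightarrow> {..<p} \<rightarrow>\<^sub>E M \<times> M"
  proof
    fix u assume u: "u \<in> openings n"
    have "length (det_run A (take t (passes p (u @ rev (bar u))))) \<le> s" for t
      using assms(3) length_openings[OF u] by (simp add: det_space_le_def)
    moreover have "k < p \<Longrightarrow> \<exists>t. take t (passes p x) = passes (Suc k) x" for k and x :: "paren list"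
      by (rule passes_take) simp
    ultimately have "k < p \<Longrightarrow> crossing A u (rev (bar u)) k \<in> M \<times> M" for k
      unfolding crossing_def M_def memories_def
      by (metis (mono_tags, lifting) SigmaI mem_Collect_eq passes_half_take)
    then show "f u \<in> {..<p} \<rightarrow>\<^sub>E M \<times> M"
      by (auto simp: f_def simp del: mem_Sigma_iff)
  qed
  have inj: "inj_on f (openings n)"
  proof (rule inj_onI)
    fix u u' assume u: "u \<in> openings n" and u': "u' \<in> openings n" and eq: "f u = f u'"
    have "crossing A u (rev (bar u)) k = crossing A u' (rev (bar u')) k" if "k < p" for k
      using fun_cong[OF eq, of k] that by (simp add: f_def)
    from det_run_mix[OF this, of p p]
    have "det_answer A p (u @ rev (bar u')) = det_answer A p (u @ rev (bar u))"
      by (simp add: det_answer_def)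
    then have "u @ rev (bar u') \<in> one_turn_Dyck2 \<longleftrightarrow> u @ rev (bar u) \<in> one_turn_Dyck2"
      using assms(2) u u' by (simp add: det_determines_def length_openings)
    then show "u = u'"
      using one_turn_Dyck2_iff assms(1) u u' by blast
  qed
  have "2 ^ n \<le> card ({..<p} \<rightarrow>\<^sub>E M \<times> M)"
    using card_inj_on_le[OF inj] range finite_memories[of s]
    by (auto simp: card_openings M_def image_subset_iff_funcset intro!: finite_PiE)
  also have "\<dots> = (card M * card M) ^ p"
    by (simp add: card_funcsetE card_cartesian_product)
  also have "\<dots> \<le> (4 ^ s * 4 ^ s) ^ p"
    unfolding M_def by (intro power_mono mult_mono card_memories_le) auto
  \<comment> \<open>Each pass contributes two memories, hence a factor
    \<open>4 ^ s * 4 ^ s = 2 ^ (4 * s)\<close>.\<close>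
  also have "\<dots> = 2 ^ (4 * s * p)"
    by (simp add: power_mult flip: power_mult_distrib)
  finally show ?thesis
    by simp
qed

section \<open>Stochastic kernels on finite sets\<close>

lemma pmf_bind_finite:
  assumes "finite D" "set_pmf M \<subseteq> D"
  shows "pmf (bind_pmf M K) y = (\<Sum>x\<in>D. pmf M x * pmf (K x) y)"
  unfolding pmf_bind using assms by (subst integral_measure_pmf[of D]) auto

lemma sum_pmf_le_1: "finite R \<Longrightarrow> (\<Sum>y\<in>R. pmf M y) \<le> 1"
  by (metis measure_measure_pmf_finite measure_pmf.prob_le_1)

text \<open>
  With \<open>K = K'\<close> and \<open>\<delta> = 0\<close> this says that a stochastic kernel does not increase the distance.
\<close>

lemma bind_pmf_distance_le:
  fixes \<delta> :: real
  assumes D: "finite D" "set_pmf M \<subseteq> D" "set_pmf M' \<subseteq> D" and R: "finite R"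
    and close: "\<And>x y. x \<in> D \<Longrightarrow> y \<in> R \<Longrightarrow> \<bar>pmf (K x) y - pmf (K' x) y\<bar> \<le> \<delta>"
  shows "(\<Sum>y\<in>R. \<bar>pmf (bind_pmf M K) y - pmf (bind_pmf M' K') y\<bar>)
           \<le> (\<Sum>x\<in>D. \<bar>pmf M x - pmf M' x\<bar>) + card R * \<delta>"
proof -
  \<comment> \<open>Split the difference as \<open>(M - M') K + M' (K - K')\<close>. The rows of
    \<open>K\<close> sum to at most 1 over \<open>R\<close>, and \<open>M'\<close> has mass 1 on
    \<open>D\<close>.\<close>
  have "(\<Sum>y\<in>R. \<bar>pmf (bind_pmf M K) y - pmf (bind_pmf M' K') y\<bar>)
      = (\<Sum>y\<in>R. \<bar>\<Sum>x\<in>D. (pmf M x - pmf M' x) * pmf (K x) y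
                     + pmf M' x * (pmf (K x) y - pmf (K' x) y)\<bar>)"
    by (simp add: pmf_bind_finite[OF D(1,2)] pmf_bind_finite[OF D(1,3)] algebra_simps
        flip: sum_subtractf)
  also have "\<dots> \<le> (\<Sum>y\<in>R. \<Sum>x\<in>D. \<bar>pmf M x - pmf M' x\<bar> * pmf (K x) y + pmf M' x * \<delta>)"
  proof (intro sum_mono order_trans[OF sum_abs])
    fix x y assume xy: "y \<in> R" "x \<in> D"
    have "\<bar>pmf M' x * (pmf (K x) y - pmf (K' x) y)\<bar> \<le> pmf M' x * \<delta>"
      using close[OF xy(2,1)] by (simp add: abs_mult mult_left_mono)
    then show "\<bar>(pmf M x - pmf M' x) * pmf (K x) y + pmf M' x * (pmf (K x) y - pmf (K' x) y)\<bar>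
        \<le> \<bar>pmf M x - pmf M' x\<bar> * pmf (K x) y + pmf M' x * \<delta>"
      by (intro order_trans[OF abs_triangle_ineq] add_mono) (simp_all add: abs_mult)
  qed
  also have "\<dots> = (\<Sum>x\<in>D. \<bar>pmf M x - pmf M' x\<bar> * (\<Sum>y\<in>R. pmf (K x) y))
                  + card R * ((\<Sum>x\<in>D. pmf M' x) * \<delta>)"
    by (subst sum.swap) (simp add: sum.distrib sum_distrib_left sum_distrib_right mult_ac)
  also have "\<dots> \<le> (\<Sum>x\<in>D. \<bar>pmf M x - pmf M' x\<bar> * 1) + card R * (1 * \<delta>)"
    using sum_pmf_eq_1[OF D(1,3)]
    by (intro add_mono sum_mono mult_left_mono sum_pmf_le_1 R) auto
  finally show ?thesis
    by simp
qed

text \<open>The kernel by which a stretch of the stream acts on the memory. Fresh coins at every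
  step make it independent of the past.\<close>

definition rand_steps ::
    "'a rand_alg \<Rightarrow> (nat \<times> 'a option) list \<Rightarrow> bool list \<Rightarrow> bool list pmf" where
  "rand_steps A xs m = foldl (\<lambda>M a. bind_pmf M (\<lambda>m. rand_step A m a)) (return_pmf m) xs"

lemma rand_run_append: "rand_run A (xs @ ys) = bind_pmf (rand_run A xs) (rand_steps A ys)"
proof (induction ys rule: rev_induct)
  case Nil
  then show ?case
    by (simp add: rand_steps_def[abs_def] bind_return_pmf')
next
  case (snoc y ys)
  have "rand_run A (xs @ ys @ [y]) = bind_pmf (rand_run A (xs @ ys)) (\<lambda>m. rand_step A m y)"
    by (simp add: rand_run_def)
  then show ?case
    by (simp add: snoc rand_steps_def[abs_def] bind_assoc_pmf)
qed

section \<open>Stability of the answer under exchange of the left half\<close>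

context
  fixes A :: "'a rand_alg" and p n s :: nat and u u' v :: "'a list" and \<delta> :: real
  assumes space: "rand_space_le A p (2 * n) s"
    and lengths: "length u = n" "length u' = n" "length v = n"
    and close: "\<And>k e m. k < p \<Longrightarrow> e \<in> memories s \<Longrightarrow> m \<in> memories s \<Longrightarrow>
      \<bar>pmf (rand_steps A (map (Pair k) (map Some u)) e) m
        - pmf (rand_steps A (map (Pair k) (map Some u')) e) m\<bar> \<le> \<delta>"
begin

lemma set_rand_run_passes:
  assumes "k \<le> p" "w \<in> {u, u'}"
  shows "set_pmf (rand_run A (passes k (w @ v))) \<subseteq> memories s"
proof -
  obtain t where "take t (passes p (w @ v)) = passes k (w @ v)"
    using passes_take[OF assms(1)] by blast
  moreover have "length (w @ v) = 2 * n"
    using assms(2) lengths by auto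
  ultimately show ?thesis
    using space unfolding rand_space_le_def memories_def by (metis mem_Collect_eq subsetI)
qed

lemma set_rand_run_half:
  assumes "k < p" "w \<in> {u, u'}"
  shows "set_pmf (rand_run A (passes k (w @ v) @ map (Pair k) (map Some w))) \<subseteq> memories s"
proof -
  obtain t where "take t (passes p (w @ v)) = passes k (w @ v) @ map (Pair k) (map Some w)"
    using passes_half_take[OF assms(1)] by blast
  moreover have "length (w @ v) = 2 * n"
    using assms(2) lengths by auto
  ultimately show ?thesis
    using space unfolding rand_space_le_def memories_def by (metis mem_Collect_eq subsetI)
qed

text \<open>Hybrid argument over the passes: the kernels of \<open>u\<close> and \<open>u'\<close>
  add at most \<open>card (memories s) * \<delta>\<close> per pass, while the kernel of
  \<open>v\<close> is shared and adds nothing.\<close>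

lemma rand_run_distance_le:
  "k \<le> p \<Longrightarrow>
    (\<Sum>m\<in>memories s. \<bar>pmf (rand_run A (passes k (u @ v))) m - pmf (rand_run A (passes k (u' @ v))) m\<bar>)
      \<le> k * (card (memories s) * \<delta>)"
proof (induction k)
  case (Suc k)
  let ?mid = "\<lambda>w. rand_run A (passes k (w @ v) @ map (Pair k) (map Some w))"
  let ?G = "rand_steps A (map (Pair k) (map Some v @ [None]))"
  have step: "rand_run A (passes (Suc k) (w @ v)) = bind_pmf (?mid w) ?G" for w
    unfolding passes_Suc_append by (metis append.assoc rand_run_append)
  have "(\<Sum>m\<in>memories s. \<bar>pmf (rand_run A (passes (Suc k) (u @ v))) m
            - pmf (rand_run A (passes (Suc k) (u' @ v))) m\<bar>)
      \<le> (\<Sum>m\<in>memories s. \<bar>pmf (?mid u) m - pmf (?mid u') m\<bar>) + real (card (memories s)) * 0"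
    unfolding step using Suc.prems
    by (intro bind_pmf_distance_le finite_memories set_rand_run_half) auto
  also have "(\<Sum>m\<in>memories s. \<bar>pmf (?mid u) m - pmf (?mid u') m\<bar>)
      \<le> (\<Sum>m\<in>memories s. \<bar>pmf (rand_run A (passes k (u @ v))) m
                 - pmf (rand_run A (passes k (u' @ v))) m\<bar>) + card (memories s) * \<delta>"
    unfolding rand_run_append using Suc.prems
    by (intro bind_pmf_distance_le finite_memories set_rand_run_passes close) auto
  also have "\<dots> \<le> k * (card (memories s) * \<delta>) + card (memories s) * \<delta>"
    using Suc by simp
  finally show ?case
    by (simp add: algebra_simps)
qed simp

lemma rand_answer_distance_le:
  "\<bar>pmf (rand_answer A p (u @ v)) True - pmf (rand_answer A p (u' @ v)) True\<bar>
     \<le> p * (card (memories s) * \<delta>)"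
proof -
  \<comment> \<open>Reading off the answer is one more shared kernel; the sum over
    \<open>{True}\<close> fits the distance estimate.\<close>
  have "(\<Sum>b\<in>{True}. \<bar>pmf (rand_answer A p (u @ v)) b - pmf (rand_answer A p (u' @ v)) b\<bar>)
      \<le> (\<Sum>m\<in>memories s. \<bar>pmf (rand_run A (passes p (u @ v))) m
                 - pmf (rand_run A (passes p (u' @ v))) m\<bar>) + real (card {True}) * 0"
    unfolding rand_answer_def
    by (intro bind_pmf_distance_le finite_memories set_rand_run_passes) auto
  with rand_run_distance_le[of p] show ?thesis
    by simp
qed

end

section \<open>Counting rounded kernels\<close>

lemma rand_determines_True:
  fixes \<epsilon> :: real
  assumes "rand_determines A p \<epsilon> L N" "length x = N"
  shows "x \<in> L \<Longrightarrow> pmf (rand_answer A p x) True \<ge> 1 - \<epsilon>"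
    and "x \<notin> L \<Longrightarrow> pmf (rand_answer A p x) True \<le> \<epsilon>"
proof -
  have le: "measure_pmf.prob (rand_answer A p x) {b. b \<noteq> (x \<in> L)} \<le> \<epsilon>"
    using assms by (simp add: rand_determines_def)
  have "{b. b \<noteq> True} = {False}" "{b. b \<noteq> False} = {True}"
    by auto
  then show "x \<in> L \<Longrightarrow> pmf (rand_answer A p x) True \<ge> 1 - \<epsilon>"
    and "x \<notin> L \<Longrightarrow> pmf (rand_answer A p x) True \<le> \<epsilon>"
    using le by (simp_all add: measure_pmf_single pmf_False_conv_True)
qed

lemma floor_eq_imp_close:
  fixes x y N :: real
  assumes "\<lfloor>N * x\<rfloor> = \<lfloor>N * y\<rfloor>" "N > 0"
  shows "\<bar>x - y\<bar> \<le> 1 / N"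
proof -
  have "\<bar>N * x - N * y\<bar> \<le> 1"
    using assms(1) by linarith
  then have "N * \<bar>x - y\<bar> \<le> 1"
    using assms(2) by (simp add: abs_mult flip: right_diff_distrib)
  then show ?thesis
    using assms(2) by (simp add: field_simps)
qed

text \<open>The right half matching \<open>u\<close> is accepted after \<open>u\<close> with
  probability at least \<open>1 - \<epsilon>\<close>, after a different \<open>u'\<close> with at
  most \<open>\<epsilon>\<close>. Kernels this close cannot produce the gap
  \<open>1 - 2 * \<epsilon>\<close>.\<close>

lemma rand_kernels_apart:
  fixes \<delta> \<epsilon> :: real
  assumes "rand_determines A p \<epsilon> one_turn_Dyck2 (2 * n)" "rand_space_le A p (2 * n) s"
    and "n \<ge> 1" "u \<in> openings n" "u' \<in> openings n"
    and "\<And>k e m. k < p \<Longrightarrow> e \<in> memories s \<Longrightarrow> m \<in> memories s \<Longrightarrow>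
      \<bar>pmf (rand_steps A (map (Pair k) (map Some u)) e) m
        - pmf (rand_steps A (map (Pair k) (map Some u')) e) m\<bar> \<le> \<delta>"
    and "p * (card (memories s) * \<delta>) < 1 - 2 * \<epsilon>"
  shows "u = u'"
proof (rule ccontr)
  assume "u \<noteq> u'"
  let ?v = "rev (bar u)"
  have len: "length u = n" "length u' = n" "length ?v = n"
    using assms(4,5) by (simp_all add: length_openings)
  have "pmf (rand_answer A p (u @ ?v)) True \<ge> 1 - \<epsilon>"
    using assms(1,3,4) len one_turn_Dyck2_iff
    by (intro rand_determines_True(1)[of A p \<epsilon> one_turn_Dyck2 "2 * n"]) auto
  moreover have "pmf (rand_answer A p (u' @ ?v)) True \<le> \<epsilon>"
    using assms(1,3,4,5) len one_turn_Dyck2_iff \<open>u \<noteq> u'\<close>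
    by (intro rand_determines_True(2)[of A p \<epsilon> one_turn_Dyck2 "2 * n"]) auto
  moreover have "\<bar>pmf (rand_answer A p (u @ ?v)) True - pmf (rand_answer A p (u' @ ?v)) True\<bar>
     \<le> p * (card (memories s) * \<delta>)"
    by (rule rand_answer_distance_le[OF assms(2) len assms(6)])
  ultimately show False
    using assms(7) by linarith
qed

lemma rand_space_bound:
  assumes "n \<ge> 1" "p \<ge> 1" "rand_determines A p \<epsilon> one_turn_Dyck2 (2 * n)"
    and "rand_space_le A p (2 * n) s" and c: "1 < real c * (1 - 2 * \<epsilon>)"
  shows "n \<le> c * p\<^sup>2 * 64 ^ s"
proof -
  define M where "M = memories s"
  define S :: nat where "S = 4 ^ s"
  \<comment> \<open>At precision \<open>1 / N\<close> the acceptance probability moves by at most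
    \<open>p * S / N = 1 / c\<close>, which is below the gap
    \<open>1 - 2 * \<epsilon>\<close>.\<close>
  define N where "N = p * S * c"
  define F where "F u k e m = pmf (rand_steps A (map (Pair k) (map Some u)) e) m"
    for u :: "paren list" and k e m
  define f where "f u = restrict (\<lambda>(k, e, m). nat \<lfloor>N * F u k e m\<rfloor>) ({..<p} \<times> M \<times> M)" for u
  have N: "N > 0"
    using assms(2) c by (cases "c = 0") (auto simp: N_def S_def)
  have range: "f \<in> openings n \<rightarrow> {..<p} \<times> M \<times> M \<rightarrow>\<^sub>E {..N}"
  proof -
    have "nat \<lfloor>N * F u k e m\<rfloor> \<le> N" for u k e m
    proof -
      have "N * F u k e m \<le> N"
        by (simp add: F_def mult_left_le pmf_le_1)
      then show ?thesis
        by linarith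
    qed
    then show ?thesis
      by (auto simp: f_def split: prod.splits)
  qed
  have inj: "inj_on f (openings n)"
  proof (rule inj_onI)
    fix u u' assume u: "u \<in> openings n" and u': "u' \<in> openings n" and eq: "f u = f u'"
    have close: "\<bar>F u k e m - F u' k e m\<bar> \<le> 1 / N"
      if "k < p" "e \<in> memories s" "m \<in> memories s" for k e m
    proof (rule floor_eq_imp_close)
      have "nat \<lfloor>N * F u k e m\<rfloor> = nat \<lfloor>N * F u' k e m\<rfloor>"
        using fun_cong[OF eq, of "(k, e, m)"] that by (simp add: f_def M_def)
      \<comment> \<open>\<open>nat\<close> sends all negative integers to 0, so recovering the
        floors takes nonnegativity.\<close>
      moreover have "\<lfloor>N * F w k e m\<rfloor> \<ge> 0" for w
        by (simp add: F_def)
      ultimately show "\<lfloor>N * F u k e m\<rfloor> = \<lfloor>N * F u' k e m\<rfloor>"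
        by (simp add: eq_nat_nat_iff)
    qed (use N in simp)
    have "real (card M) \<le> real S"
      using card_memories_le[of s] unfolding M_def S_def by (rule of_nat_mono)
    then have "p * (card M * (1 / N)) \<le> p * (S * (1 / N))"
      by (intro mult_left_mono mult_right_mono) simp_all
    also have "\<dots> = 1 / c"
      using N by (simp add: N_def)
    also have "\<dots> < 1 - 2 * \<epsilon>"
      using c N by (cases "c = 0") (auto simp: field_simps)
    finally have "p * (card (memories s) * (1 / N)) < 1 - 2 * \<epsilon>"
      by (simp add: M_def)
    then show "u = u'"
      using close unfolding F_def
      by (intro rand_kernels_apart[OF assms(3,4,1) u u']) auto
  qed
  have "2 ^ n \<le> card ({..<p} \<times> M \<times> M \<rightarrow>\<^sub>E {..N})"
    using card_inj_on_le[OF inj] range finite_memories[of s]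
    by (auto simp: card_openings M_def image_subset_iff_funcset intro!: finite_PiE)
  also have "\<dots> = (N + 1) ^ (p * (card M * card M))"
    using finite_memories[of s] by (simp add: card_funcsetE card_cartesian_product M_def)
  also have "\<dots> \<le> (N + 1) ^ (p * (S * S))"
    unfolding M_def S_def by (intro power_increasing mult_mono card_memories_le) auto
  \<comment> \<open>Crude, but the resulting bound on \<open>n\<close> is still polynomial in
    \<open>p\<close> and \<open>S\<close>, which suffices for \<open>log n\<close>.\<close>
  also have "\<dots> \<le> (2 ^ N) ^ (p * (S * S))"
    by (intro power_mono) (simp_all add: Suc_le_eq)
  also have "\<dots> = 2 ^ (c * p\<^sup>2 * (S * S * S))"
    by (simp add: N_def power2_eq_square mult_ac flip: power_mult)
  also have "S * S * S = 64 ^ s"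
    by (simp add: S_def flip: power_mult_distrib)
  finally show ?thesis
    by simp
qed

section \<open>Logarithmic form of the randomized bound\<close>

lemma rand_space_pos:
  assumes "n \<ge> 1" "rand_determines A p \<epsilon> one_turn_Dyck2 (2 * n)"
    and "rand_space_le A p (2 * n) s" "\<epsilon> < 1 / 2"
  shows "s \<ge> 1"
proof (rule ccontr)
  assume "\<not> s \<ge> 1"
  then have "s = 0"
    by simp
  then have "rand_space_le A p (2 * n) 0"
    using assms(3) by simp
  \<comment> \<open>Without space the memory is always \<open>[]\<close>, so the answer has the same
    distribution on all inputs of this length.\<close>
  then have run: "rand_run A (passes p x) = return_pmf []" if "length x = 2 * n" for x
  proof -
    obtain t where "take t (passes p x) = passes p x"
      using passes_take by blast
    with \<open>rand_space_le A p (2 * n) 0\<close> that have "set_pmf (rand_run A (passes p x)) \<subseteq> {[]}"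
      unfolding rand_space_le_def by (metis le_zero_eq length_0_conv singletonI subsetI)
    then show ?thesis
      by (simp add: set_pmf_subset_singleton)
  qed
  let ?u = "replicate n LPar" and ?v = "replicate n LBrk"
  have u: "?u \<in> openings n" and v: "?v \<in> openings n" and "?u \<noteq> ?v"
    using assms(1) by (auto simp: openings_def replicate_eq_replicate)
  then have "?u @ rev (bar ?u) \<in> one_turn_Dyck2" "?u @ rev (bar ?v) \<notin> one_turn_Dyck2"
    using one_turn_Dyck2_iff[OF assms(1)] by blast+
  then have "1 - \<epsilon> \<le> pmf (rand_answer A p (?u @ rev (bar ?u))) True"
    "pmf (rand_answer A p (?u @ rev (bar ?v))) True \<le> \<epsilon>"
    using rand_determines_True[OF assms(2)] by simp_all
  then show False
    using assms(4) by (simp add: rand_answer_def run)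
qed

text \<open>Takes logarithms in \<open>rand_space_bound\<close>. The contribution of
  \<open>p\<close> is absorbed into \<open>p * s\<close>, because \<open>s \<ge> 1\<close> gives
  \<open>p \<le> 2 ^ (p * s)\<close>.\<close>

lemma rand_space_log_bound:
  assumes "n \<ge> 1" "p \<ge> 1" "rand_determines A p \<epsilon> one_turn_Dyck2 (2 * n)"
    and "rand_space_le A p (2 * n) s" "\<epsilon> < 1 / 2" and c: "1 < real c * (1 - 2 * \<epsilon>)"
  shows "log 2 n \<le> log 2 c + 8 * (p * s)"
proof -
  have s: "s \<ge> 1"
    using rand_space_pos assms by blast
  have c0: "c > 0"
    using c by (cases "c = 0") auto
  have "p * 1 \<le> p * s"
    using s by (intro mult_left_mono) auto
  then have "p \<le> p * s"
    by simp
  then have p: "p \<le> 2 ^ (p * s)"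
    using less_exp[of "p * s"] by linarith
  have "n \<le> c * p\<^sup>2 * 64 ^ s"
    by (rule rand_space_bound[OF assms(1-4) c])
  also have "\<dots> \<le> c * (2 ^ (p * s))\<^sup>2 * 64 ^ (p * s)"
    using p assms(2) by (intro mult_mono power_mono power_increasing) auto
  \<comment> \<open>The square turns base 2 into 4, and \<open>4 * 64 = 256 = 2 ^ 8\<close> yields
    the factor 8.\<close>
  also have "\<dots> = c * 256 ^ (p * s)"
    by (simp add: power2_eq_square flip: power_mult_distrib)
  finally have "real n \<le> real c * 256 ^ (p * s)"
    by (simp flip: of_nat_le_iff[where 'a = real])
  then have "log 2 n \<le> log 2 (real c * (2 ^ 8) ^ (p * s))"
    using assms(1) c0 by (intro log_mono) auto
  also have "\<dots> = log 2 c + 8 * (p * s)"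
    using c0 by (simp only: flip: power_mult) (simp add: log_mult log_nat_power)
  finally show ?thesis .
qed

section \<open>Asymptotic form of both bounds\<close>

theorem theorem2:
  shows
    "(\<forall>(\<epsilon>::real) (p::nat \<Rightarrow> nat) (s::nat \<Rightarrow> nat) (A::nat \<Rightarrow> paren rand_alg).
        \<epsilon> < 1 / 2 \<longrightarrow>
        (\<forall>n\<ge>1. p n \<ge> 1 \<and>
           rand_determines (A n) (p n) \<epsilon> one_turn_Dyck2 (2 * n) \<and>
           rand_space_le (A n) (p n) (2 * n) (s n)) \<longrightarrow>
        (\<lambda>n. real (s n)) \<in> \<Omega>(\<lambda>n. log 2 (real n) / real (p n)))
     \<and>
     (\<forall>(p::nat \<Rightarrow> nat) (s::nat \<Rightarrow> nat) (A::nat \<Rightarrow> paren det_alg).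
        (\<forall>n\<ge>1. p n \<ge> 1 \<and>
           det_determines (A n) (p n) one_turn_Dyck2 (2 * n) \<and>
           det_space_le (A n) (p n) (2 * n) (s n)) \<longrightarrow>
        (\<lambda>n. real (s n)) \<in> \<Omega>(\<lambda>n. real n / real (p n)))"
proof (intro conjI allI impI)
  fix \<epsilon> :: real and p s :: "nat \<Rightarrow> nat" and A :: "nat \<Rightarrow> paren rand_alg"
  assume \<epsilon>: "\<epsilon> < 1 / 2"
    and A: "\<forall>n\<ge>1. p n \<ge> 1 \<and> rand_determines (A n) (p n) \<epsilon> one_turn_Dyck2 (2 * n) \<and>
      rand_space_le (A n) (p n) (2 * n) (s n)"
  obtain c :: nat where c: "1 < real c * (1 - 2 * \<epsilon>)"
    using ex_less_of_nat_mult[of "1 - 2 * \<epsilon>" 1] \<epsilon> by auto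
  then have c0: "c > 0"
    by (cases "c = 0") auto
  \<comment> \<open>Once \<open>n\<close> is at least the square of \<open>c\<close>,
    \<open>log 2 c\<close> is at most half of \<open>log 2 n\<close>; absorbing it doubles the
    factor 8 to 16.\<close>
  have "eventually (\<lambda>n. norm (real (s n)) \<ge> 1 / 16 * norm (log 2 n / p n)) at_top"
    using eventually_ge_at_top[of "c\<^sup>2"]
  proof eventually_elim
    case (elim n)
    then have n: "n \<ge> 1"
      using c0 by (metis One_nat_def Suc_leI le_trans zero_less_power)
    have "2 * log 2 c = log 2 ((real c)\<^sup>2)"
      using c0 by (simp add: log_nat_power)
    also have "\<dots> \<le> log 2 n"
      using elim c0 by (intro log_mono) (simp_all flip: of_nat_power)
    finally have "log 2 n \<le> 16 * (real (p n) * real (s n))"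
      using rand_space_log_bound[OF n _ _ _ \<epsilon> c, of "p n" "A n" "s n"] A n by simp
    moreover have "p n \<ge> 1"
      using A n by blast
    moreover have "log 2 n \<ge> 0"
      using n by simp
    ultimately show ?case
      by (simp add: pos_divide_le_eq mult_ac)
  qed
  then show "(\<lambda>n. real (s n)) \<in> \<Omega>(\<lambda>n. log 2 (real n) / real (p n))"
    by (intro landau_omega.bigI[of "1 / 16"]) auto
next
  fix p s :: "nat \<Rightarrow> nat" and A :: "nat \<Rightarrow> paren det_alg"
  assume A: "\<forall>n\<ge>1. p n \<ge> 1 \<and> det_determines (A n) (p n) one_turn_Dyck2 (2 * n) \<and>
      det_space_le (A n) (p n) (2 * n) (s n)"
  have "eventually (\<lambda>n. norm (real (s n)) \<ge> 1 / 4 * norm (real n / p n)) at_top"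
    using eventually_ge_at_top[of 1]
  proof eventually_elim
    case (elim n)
    then have "n \<le> 4 * s n * p n"
      using A by (intro det_space_bound) auto
    then have "real n \<le> 4 * real (s n) * real (p n)"
      by (simp flip: of_nat_le_iff[where 'a = real])
    moreover have "p n \<ge> 1"
      using A elim by blast
    ultimately show ?case
      by (simp add: pos_divide_le_eq mult_ac)
  qed
  then show "(\<lambda>n. real (s n)) \<in> \<Omega>(\<lambda>n. real n / real (p n))"
    by (intro landau_omega.bigI[of "1 / 4"]) auto
qed

end
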